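(* Let $\|w\|_{L^\infty(\Omega)}\le\bar c_0\le\bar v/\sqrt5$ and $\|w_x\|_{L^\infty(\Omega)}\le\bar c_1$, and let $\underline v^2:=\bar v^2-\bar c_0^2$. Then for any $\xi\in X$ and $\delta\xi\in\delta X$, the first directional derivative of $f$ satisfies (pointwise in $\tau$) $$|f'(\xi,\xi_\tau)[\delta\xi,\delta\xi_\tau]|\le\bar\alpha_0\|\xi_\tau\|\|\delta\xi\|+\bar\alpha_1\|\delta\xi_\tau\|,\qquad\bar\alpha_0=\frac{21\bar c_1}{4\underline v^2},\ \ \bar\alpha_1=\frac{7}{2\underline v}.$$
   Context: Fix $\bar v>0$, $x_O\ne x_D\in\mathbb R^2$, $w\in C^3(\mathbb R^2,\mathbb R^2)$ with $\|w(x)\|<\bar v$; $w_x$ is its Jacobian (operator norm); $\Omega\subset\mathbb R^2$ is an ellipse with foci $x_O,x_D$ containing every globally optimal trajectory, and $\|g\|_{L^\infty(\Omega)}$ is the essential supremum over $\Omega$ of the pointwise norm. $f(x,p)=\frac{-p^Tw(x)+\sqrt{(p^Tw(x))^2+(\bar v^2-w(x)^Tw(x))p^Tp}}{\bar v^2-w(x)^Tw(x)}$; $f'(\xi,\xi_\tau)[\delta\xi,\delta\xi_\tau]$ is the derivative of $f$ with respect to $(x,p)$ at $(\xi(\tau),\xi_\tau(\tau))$ in direction $(\delta\xi(\tau),\delta\xi_\tau(\tau))$. $X=\{\xi\in W^{1,\infty}(]0,1[,\mathbb R^2):\xi(0)=x_O,\xi(1)=x_D\}$, $\delta X=W_0^{1,\infty}(]0,1[,\mathbb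 R^2)$; subscript $\tau$ denotes the derivative; $\|\cdot\|$ is the Euclidean norm. *)

theory Defs
  imports "HOL-Analysis.Analysis"
begin

text \<open>The cost integrand f(x,p) of the paper (travel time density).\<close>
definition fcost :: "real \<Rightarrow> (real^2 \<Rightarrow> real^2) \<Rightarrow> real^2 \<Rightarrow> real^2 \<Rightarrow> real" where
  "fcost vbar w x p =
     (- (p \<bullet> w x) + sqrt ((p \<bullet> w x)^2 + (vbar^2 - w x \<bullet> w x) * (p \<bullet> p)))
     / (vbar^2 - w x \<bullet> w x)"

definition ellipse :: "real^2 \<Rightarrow> real^2 \<Rightarrow> real \<Rightarrow> (real^2) set" where
  "ellipse xO xD a = {x. dist x xO + dist x xD < a}"

definition C3 :: "(real^2 \<Rightarrow> real^2) \<Rightarrow> bool" where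
  "C3 w \<longleftrightarrow> (\<exists>(D1 :: real^2 \<Rightarrow> ((real^2) \<Rightarrow>\<^sub>L (real^2)))
        (D2 :: real^2 \<Rightarrow> ((real^2) \<Rightarrow>\<^sub>L ((real^2) \<Rightarrow>\<^sub>L (real^2))))
        (D3 :: real^2 \<Rightarrow> ((real^2) \<Rightarrow>\<^sub>L ((real^2) \<Rightarrow>\<^sub>L ((real^2) \<Rightarrow>\<^sub>L (real^2))))).
      (\<forall>x. (w has_derivative blinfun_apply (D1 x)) (at x)) \<and>
      (\<forall>x. (D1 has_derivative blinfun_apply (D2 x)) (at x)) \<and>
      (\<forall>x. (D2 has_derivative blinfun_apply (D3 x)) (at x)) \<and>
      continuous_on UNIV D3)"

text \<open>X: W^{1,infty} (= Lipschitz) curves on [0,1] from xO to xD; deltaX: with zero ends.\<close>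
definition trajX :: "real^2 \<Rightarrow> real^2 \<Rightarrow> (real \<Rightarrow> real^2) set" where
  "trajX xO xD = {\<xi>. (\<exists>L. L-lipschitz_on {0..1} \<xi>) \<and> \<xi> 0 = xO \<and> \<xi> 1 = xD}"

definition deltaX :: "(real \<Rightarrow> real^2) set" where
  "deltaX = {\<eta>. (\<exists>L. L-lipschitz_on {0..1} \<eta>) \<and> \<eta> 0 = 0 \<and> \<eta> 1 = 0}"

end

theory Submission
  imports Defs
begin

(* Write a = vbar^2 - |w|^2, b = p.w and s = sqrt (b^2 + a |p|^2), so that f = (s - b) / a.
   Differentiating along (x + t dx, p + t dp) splits f' into a part linear in dp and a part
   linear in l = w_x dx. The hypothesis c0 <= vbar / sqrt 5 says 2 c0 <= vlow, where
   vlow = sqrt (vbar^2 - c0^2); hence |w| <= sqrt a / 2 and vlow <= sqrt a. Together with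
   sqrt a |p| <= s <= |b| + sqrt a |p| and |b| <= s, Cauchy-Schwarz bounds the two parts by
   (2 / vlow) |dp| and (9 / (2 vlow^2)) |p| |l|, slightly better than the constants 7/2 and 21/4.
   At p = 0 the square root is not differentiable, but f(x, 0) = 0 is a minimum of f >= 0,
   so the derivative vanishes. *)

(* For p \<noteq> 0, fcost_p_deriv vbar (w x) p q + fcost_x_deriv vbar (w x) p (w_x(x) h) is the
   paper's f'(x, p)[h, q]. *)
definition fcost_p_deriv :: "real \<Rightarrow> 'a::real_inner \<Rightarrow> 'a \<Rightarrow> 'a \<Rightarrow> real" where
  "fcost_p_deriv vbar wx p q =
     (let a = vbar^2 - wx \<bullet> wx; b = p \<bullet> wx; s = sqrt (b^2 + a * (p \<bullet> p))
      in (- (q \<bullet> wx) + (b * (q \<bullet> wx) + a * (p \<bullet> q)) / s) / a)"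

definition fcost_x_deriv :: "real \<Rightarrow> 'a::real_inner \<Rightarrow> 'a \<Rightarrow> 'a \<Rightarrow> real" where
  "fcost_x_deriv vbar wx p l =
     (let a = vbar^2 - wx \<bullet> wx; b = p \<bullet> wx; s = sqrt (b^2 + a * (p \<bullet> p))
      in (- (p \<bullet> l) + (b * (p \<bullet> l) - (wx \<bullet> l) * (p \<bullet> p)) / s) / a
         + 2 * (s - b) * (wx \<bullet> l) / a^2)"

lemma has_real_derivative_travel_time:
  fixes A B P :: "real \<Rightarrow> real"
  assumes "(A has_real_derivative A') (at t)" and "(B has_real_derivative B') (at t)"
    and "(P has_real_derivative P') (at t)"
    and "A t = a" and "B t = b" and "P t = \<pi>" and "a \<noteq> 0" and "b^2 + a * \<pi> > 0"
  shows "((\<lambda>t. (- B t + sqrt ((B t)^2 + A t * P t)) / A t) has_real_derivative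
    (- B' + (2 * b * B' + A' * \<pi> + a * P') / (2 * sqrt (b^2 + a * \<pi>))) / a
    - (- b + sqrt (b^2 + a * \<pi>)) * A' / a^2) (at t)"
  using assms
  by (auto intro!: derivative_eq_intros simp: field_simps power2_eq_square)

lemma inner_self_lt_square: "norm (x :: 'a::real_inner) < v \<Longrightarrow> x \<bullet> x < v^2"
  by (metis norm_ge_zero power2_norm_eq_inner power_strict_mono zero_less_numeral)

lemma fcost_nonneg:
  assumes "norm (w y) < vbar"
  shows "0 \<le> fcost vbar w y r"
proof -
  have "0 < vbar^2 - w y \<bullet> w y" using inner_self_lt_square[OF assms] by simp
  moreover have "\<bar>r \<bullet> w y\<bar> \<le> sqrt ((r \<bullet> w y)^2 + (vbar^2 - w y \<bullet> w y) * (r \<bullet> r))"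
    using calculation by (simp add: real_le_rsqrt)
  ultimately show ?thesis unfolding fcost_def by (intro divide_nonneg_pos) auto
qed

lemma fcost_zero_velocity [simp]: "fcost vbar w y 0 = 0"
  by (simp add: fcost_def)

lemma has_real_derivative_fcost_line:
  fixes w :: "real^2 \<Rightarrow> real^2"
  assumes w': "(w has_derivative L) (at x)" and w_lt: "norm (w x) < vbar" and "p \<noteq> 0"
  shows "((\<lambda>t. fcost vbar w (x + t *\<^sub>R h) (p + t *\<^sub>R q)) has_real_derivative
           fcost_p_deriv vbar (w x) p q + fcost_x_deriv vbar (w x) p (L h)) (at 0)"
proof -
  define a where "a = vbar^2 - w x \<bullet> w x"
  define b where "b = p \<bullet> w x"
  define s where "s = sqrt (b^2 + a * (p \<bullet> p))"
  have "a > 0" using inner_self_lt_square[OF w_lt] by (simp add: a_def)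
  then have "b^2 + a * (p \<bullet> p) > 0"
    using \<open>p \<noteq> 0\<close> by (simp add: add_nonneg_pos)
  then have "s > 0" by (simp add: s_def)
  have "bounded_linear L" using w' by (rule has_derivative_bounded_linear)
  have line: "((\<lambda>t. x + t *\<^sub>R h) has_derivative (\<lambda>t. t *\<^sub>R h)) (at 0)"
    "((\<lambda>t. p + t *\<^sub>R q) has_derivative (\<lambda>t. t *\<^sub>R q)) (at 0)"
    by (auto intro!: derivative_eq_intros)
  have wline: "((\<lambda>t. w (x + t *\<^sub>R h)) has_derivative (\<lambda>t. t *\<^sub>R L h)) (at 0)"
    using diff_chain_at[OF line(1), of w L] w' \<open>bounded_linear L\<close>
    by (simp add: o_def linear_simps)
  have "((\<lambda>t. vbar^2 - w (x + t *\<^sub>R h) \<bullet> w (x + t *\<^sub>R h)) has_real_derivative - 2 * (w x \<bullet> L h)) (at 0)"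
    "((\<lambda>t. (p + t *\<^sub>R q) \<bullet> w (x + t *\<^sub>R h)) has_real_derivative q \<bullet> w x + p \<bullet> L h) (at 0)"
    "((\<lambda>t. (p + t *\<^sub>R q) \<bullet> (p + t *\<^sub>R q)) has_real_derivative 2 * (p \<bullet> q)) (at 0)"
    unfolding has_field_derivative_def
    by (auto intro!: derivative_eq_intros wline simp: fun_eq_iff algebra_simps inner_commute)
  note deriv = has_real_derivative_travel_time[OF this(1,2,3)]
  show ?thesis
    unfolding fcost_def
  proof (rule DERIV_cong[OF deriv])
    show "vbar^2 - w (x + 0 *\<^sub>R h) \<bullet> w (x + 0 *\<^sub>R h) = a"
      "(p + 0 *\<^sub>R q) \<bullet> w (x + 0 *\<^sub>R h) = b" "(p + 0 *\<^sub>R q) \<bullet> (p + 0 *\<^sub>R q) = p \<bullet> p"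
      by (simp_all add: a_def b_def)
    show "(- (q \<bullet> w x + p \<bullet> L h) + (2 * b * (q \<bullet> w x + p \<bullet> L h) + - 2 * (w x \<bullet> L h) * (p \<bullet> p)
            + a * (2 * (p \<bullet> q))) / (2 * sqrt (b^2 + a * (p \<bullet> p)))) / a
          - (- b + sqrt (b^2 + a * (p \<bullet> p))) * (- 2 * (w x \<bullet> L h)) / a^2
        = fcost_p_deriv vbar (w x) p q + fcost_x_deriv vbar (w x) p (L h)"
      using \<open>a > 0\<close> \<open>s > 0\<close>
      by (simp add: fcost_p_deriv_def fcost_x_deriv_def Let_def flip: a_def b_def s_def)
         (simp add: field_simps power2_eq_square)
  qed (use \<open>a > 0\<close> \<open>b^2 + a * (p \<bullet> p) > 0\<close> in auto)
qed

lemma travel_time_root_bounds: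
  fixes wx p :: "'a::real_inner"
  assumes "p \<noteq> 0" and "0 < u" and "u^2 \<le> vbar^2 - (norm wx)^2"
  defines "a \<equiv> vbar^2 - wx \<bullet> wx"
  defines "s \<equiv> sqrt ((p \<bullet> wx)^2 + a * (p \<bullet> p))"
  shows "0 < a" and "u \<le> sqrt a" and "\<bar>p \<bullet> wx\<bar> \<le> s" and "sqrt a * norm p \<le> s"
    and "s \<le> \<bar>p \<bullet> wx\<bar> + sqrt a * norm p" and "0 < s"
proof -
  have "u^2 \<le> a" using assms(3) by (simp add: a_def power2_norm_eq_inner)
  moreover have "0 < u^2" using \<open>0 < u\<close> by simp
  ultimately show "0 < a" by linarith
  then show "u \<le> sqrt a" using \<open>u^2 \<le> a\<close> \<open>0 < u\<close> by (simp add: real_le_rsqrt)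
  have s: "s = sqrt ((p \<bullet> wx)^2 + a * (norm p)^2)"
    by (simp add: s_def power2_norm_eq_inner)
  show "\<bar>p \<bullet> wx\<bar> \<le> s"
    unfolding s using \<open>0 < a\<close> by (simp add: real_le_rsqrt)
  show "sqrt a * norm p \<le> s"
    unfolding s using \<open>0 < a\<close> by (simp add: real_le_rsqrt power_mult_distrib)
  then show "0 < s"
    using \<open>0 < a\<close> \<open>p \<noteq> 0\<close> by (smt (verit) mult_pos_pos real_sqrt_gt_zero zero_less_norm_iff)
  have "s \<le> sqrt ((p \<bullet> wx)^2) + sqrt (a * (norm p)^2)"
    unfolding s using \<open>0 < a\<close> by (intro sqrt_add_le_add_sqrt) auto
  then show "s \<le> \<bar>p \<bullet> wx\<bar> + sqrt a * norm p"
    using \<open>0 < a\<close> by (simp add: real_sqrt_mult)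
qed

lemma abs_fcost_p_deriv_le:
  fixes wx p q :: "'a::real_inner"
  assumes "p \<noteq> 0" and "0 < u" and "2 * norm wx \<le> u" and "u^2 \<le> vbar^2 - (norm wx)^2"
  shows "\<bar>fcost_p_deriv vbar wx p q\<bar> \<le> 2 / u * norm q"
proof -
  define a where "a = vbar^2 - wx \<bullet> wx"
  define b where "b = p \<bullet> wx"
  define s where "s = sqrt (b^2 + a * (p \<bullet> p))"
  define \<sigma> where "\<sigma> = sqrt a"
  note roots = travel_time_root_bounds[OF \<open>p \<noteq> 0\<close> \<open>0 < u\<close> assms(4),
      folded a_def b_def, folded s_def \<sigma>_def]
  have "0 < a" "u \<le> \<sigma>" "\<bar>b\<bar> \<le> s" "\<sigma> * norm p \<le> s" "0 < s"
    using roots by simp_all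
  then have "0 < \<sigma>" and "a = \<sigma>^2"
    using \<open>0 < u\<close> by (simp_all add: \<sigma>_def)
  have "\<bar>b * (q \<bullet> wx) / s\<bar> \<le> norm q * norm wx"
  proof -
    have "\<bar>b * (q \<bullet> wx) / s\<bar> = \<bar>b\<bar> / s * \<bar>q \<bullet> wx\<bar>"
      using \<open>0 < s\<close> by (simp add: abs_mult)
    also have "\<dots> \<le> 1 * \<bar>q \<bullet> wx\<bar>"
      using \<open>\<bar>b\<bar> \<le> s\<close> \<open>0 < s\<close> by (intro mult_right_mono) auto
    finally show ?thesis using Cauchy_Schwarz_ineq2[of q wx] by simp
  qed
  have "\<bar>a * (p \<bullet> q) / s\<bar> \<le> \<sigma> * norm q"
  proof -
    have "\<bar>a * (p \<bullet> q) / s\<bar> \<le> a * (norm p * norm q) / s"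
      using \<open>0 < a\<close> \<open>0 < s\<close> Cauchy_Schwarz_ineq2[of p q]
      by (simp add: abs_mult divide_right_mono)
    also have "\<dots> \<le> a * (norm p * norm q) / (\<sigma> * norm p)"
      using \<open>0 < a\<close> \<open>0 < \<sigma>\<close> \<open>p \<noteq> 0\<close> \<open>\<sigma> * norm p \<le> s\<close> \<open>0 < s\<close>
      by (intro divide_left_mono) auto
    also have "\<dots> = \<sigma> * norm q"
      using \<open>a = \<sigma>^2\<close> \<open>0 < \<sigma>\<close> \<open>p \<noteq> 0\<close> by (simp add: power2_eq_square)
    finally show ?thesis .
  qed
  have "2 * (norm q * norm wx) \<le> \<sigma> * norm q"
    using mult_right_mono[OF order_trans[OF \<open>2 * norm wx \<le> u\<close> \<open>u \<le> \<sigma>\<close>] norm_ge_zero[of q]]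
    by (simp add: ac_simps)
  have "\<bar>- (q \<bullet> wx) + (b * (q \<bullet> wx) + a * (p \<bullet> q)) / s\<bar>
      \<le> \<bar>q \<bullet> wx\<bar> + \<bar>b * (q \<bullet> wx) / s\<bar> + \<bar>a * (p \<bullet> q) / s\<bar>"
    unfolding add_divide_distrib by linarith
  also have "\<dots> \<le> 2 * \<sigma> * norm q"
    using \<open>\<bar>b * (q \<bullet> wx) / s\<bar> \<le> norm q * norm wx\<close> \<open>\<bar>a * (p \<bullet> q) / s\<bar> \<le> \<sigma> * norm q\<close>
      \<open>2 * (norm q * norm wx) \<le> \<sigma> * norm q\<close> Cauchy_Schwarz_ineq2[of q wx]
    by linarith
  finally have "\<bar>fcost_p_deriv vbar wx p q\<bar> \<le> 2 * \<sigma> * norm q / a"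
    unfolding fcost_p_deriv_def Let_def a_def [symmetric] b_def [symmetric] s_def [symmetric] abs_divide
    using \<open>0 < a\<close> by (simp add: divide_right_mono)
  also have "\<dots> = 2 / \<sigma> * norm q"
    using \<open>0 < \<sigma>\<close> \<open>a = \<sigma>^2\<close> by (simp add: power2_eq_square)
  also have "\<dots> \<le> 2 / u * norm q"
    using \<open>0 < u\<close> \<open>u \<le> \<sigma>\<close> by (intro mult_right_mono divide_left_mono) auto
  finally show ?thesis .
qed

lemma abs_fcost_x_deriv_le:
  fixes wx p l :: "'a::real_inner"
  assumes "p \<noteq> 0" and "0 < u" and "2 * norm wx \<le> u" and "u^2 \<le> vbar^2 - (norm wx)^2"
  shows "\<bar>fcost_x_deriv vbar wx p l\<bar> \<le> 9 / (2 * u^2) * norm p * norm l"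
proof -
  define a where "a = vbar^2 - wx \<bullet> wx"
  define b where "b = p \<bullet> wx"
  define s where "s = sqrt (b^2 + a * (p \<bullet> p))"
  define \<sigma> where "\<sigma> = sqrt a"
  note roots = travel_time_root_bounds[OF \<open>p \<noteq> 0\<close> \<open>0 < u\<close> assms(4),
      folded a_def b_def, folded s_def \<sigma>_def]
  have "0 < a" "u \<le> \<sigma>" "\<bar>b\<bar> \<le> s" "\<sigma> * norm p \<le> s" "s \<le> \<bar>b\<bar> + \<sigma> * norm p" "0 < s"
    using roots by simp_all
  then have "0 < \<sigma>" and "a = \<sigma>^2"
    using \<open>0 < u\<close> by (simp_all add: \<sigma>_def)
  have "2 * norm wx \<le> \<sigma>" using assms(3) \<open>u \<le> \<sigma>\<close> by linarith
  have wl: "\<bar>wx \<bullet> l\<bar> \<le> \<sigma> / 2 * norm l"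
    using Cauchy_Schwarz_ineq2[of wx l] mult_right_mono[OF \<open>2 * norm wx \<le> \<sigma>\<close> norm_ge_zero[of l]]
    by simp
  have "\<bar>b * (p \<bullet> l) / s\<bar> \<le> norm p * norm l"
  proof -
    have "\<bar>b * (p \<bullet> l) / s\<bar> = \<bar>b\<bar> / s * \<bar>p \<bullet> l\<bar>"
      using \<open>0 < s\<close> by (simp add: abs_mult)
    also have "\<dots> \<le> 1 * \<bar>p \<bullet> l\<bar>"
      using \<open>\<bar>b\<bar> \<le> s\<close> \<open>0 < s\<close> by (intro mult_right_mono) auto
    finally show ?thesis using Cauchy_Schwarz_ineq2[of p l] by simp
  qed
  have "\<bar>(wx \<bullet> l) * (p \<bullet> p) / s\<bar> \<le> norm p * norm l / 2"
  proof -
    have "\<bar>(wx \<bullet> l) * (p \<bullet> p) / s\<bar> = \<bar>wx \<bullet> l\<bar> * ((norm p)^2 / s)"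
      using \<open>0 < s\<close> by (simp add: abs_mult power2_norm_eq_inner)
    also have "\<dots> \<le> \<sigma> / 2 * norm l * (norm p / \<sigma>)"
    proof (rule mult_mono)
      show "(norm p)^2 / s \<le> norm p / \<sigma>"
        using mult_right_mono[OF \<open>\<sigma> * norm p \<le> s\<close> norm_ge_zero[of p]] \<open>0 < s\<close> \<open>0 < \<sigma>\<close>
        by (simp add: field_simps power2_eq_square)
    qed (use wl \<open>0 < \<sigma>\<close> \<open>0 < s\<close> in auto)
    also have "\<dots> = norm p * norm l / 2" using \<open>0 < \<sigma>\<close> by simp
    finally show ?thesis .
  qed
  have "\<bar>- (p \<bullet> l) + (b * (p \<bullet> l) - (wx \<bullet> l) * (p \<bullet> p)) / s\<bar>
      \<le> \<bar>p \<bullet> l\<bar> + \<bar>b * (p \<bullet> l) / s\<bar> + \<bar>(wx \<bullet> l) * (p \<bullet> p) / s\<bar>"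
    unfolding diff_divide_distrib by linarith
  also have "\<dots> \<le> 5 / 2 * (norm p * norm l)"
    using \<open>\<bar>b * (p \<bullet> l) / s\<bar> \<le> norm p * norm l\<close> \<open>\<bar>(wx \<bullet> l) * (p \<bullet> p) / s\<bar> \<le> norm p * norm l / 2\<close>
      Cauchy_Schwarz_ineq2[of p l]
    by linarith
  finally have velocity_part: "\<bar>(- (p \<bullet> l) + (b * (p \<bullet> l) - (wx \<bullet> l) * (p \<bullet> p)) / s) / a\<bar>
      \<le> 5 / 2 * (norm p * norm l) / a"
    unfolding abs_divide abs_of_pos[OF \<open>0 < a\<close>] by (rule divide_right_mono) (use \<open>0 < a\<close> in simp)
  have "\<bar>s - b\<bar> \<le> 2 * \<sigma> * norm p"
  proof -
    have "\<bar>b\<bar> \<le> norm p * norm wx" unfolding b_def by (rule Cauchy_Schwarz_ineq2)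
    moreover have "2 * (norm p * norm wx) \<le> \<sigma> * norm p"
      using mult_right_mono[OF \<open>2 * norm wx \<le> \<sigma>\<close> norm_ge_zero[of p]] by (simp add: ac_simps)
    ultimately show ?thesis
      using \<open>\<bar>b\<bar> \<le> s\<close> \<open>s \<le> \<bar>b\<bar> + \<sigma> * norm p\<close> by linarith
  qed
  then have "\<bar>s - b\<bar> * \<bar>wx \<bullet> l\<bar> \<le> (2 * \<sigma> * norm p) * (\<sigma> / 2 * norm l)"
    using wl \<open>0 < \<sigma>\<close> by (intro mult_mono) auto
  then have "\<bar>s - b\<bar> * \<bar>wx \<bullet> l\<bar> \<le> a * (norm p * norm l)"
    using \<open>a = \<sigma>^2\<close> by (simp add: power2_eq_square ac_simps)
  then have "2 * (\<bar>s - b\<bar> * \<bar>wx \<bullet> l\<bar>) / a^2 \<le> 2 * (a * (norm p * norm l)) / a^2"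
    by (intro divide_right_mono mult_left_mono) auto
  also have "\<dots> = 2 * (norm p * norm l) / a"
    using \<open>0 < a\<close> by (simp add: power2_eq_square)
  finally have wind_part: "\<bar>2 * (s - b) * (wx \<bullet> l) / a^2\<bar> \<le> 2 * (norm p * norm l) / a"
    by (simp only: abs_mult abs_divide abs_numeral abs_power2 mult.assoc)
  have "\<bar>fcost_x_deriv vbar wx p l\<bar> \<le> 9 / 2 * (norm p * norm l) / a"
  proof -
    have "5 / 2 * (norm p * norm l) / a + 2 * (norm p * norm l) / a = 9 / 2 * (norm p * norm l) / a"
      by (simp add: field_simps)
    with order_trans[OF abs_triangle_ineq add_mono[OF velocity_part wind_part]] show ?thesis
      unfolding fcost_x_deriv_def Let_def a_def [symmetric] b_def [symmetric] s_def [symmetric]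
      by (simp add: ac_simps)
  qed
  also have "\<dots> \<le> 9 / 2 * (norm p * norm l) / u^2"
    using \<open>a = \<sigma>^2\<close> \<open>u \<le> \<sigma>\<close> \<open>0 < u\<close> \<open>0 < a\<close>
    by (intro divide_left_mono power_mono mult_pos_pos) auto
  also have "\<dots> = 9 / (2 * u^2) * norm p * norm l"
    by simp
  finally show ?thesis .
qed

lemma abs_fcost_line_deriv_le:
  fixes w :: "real^2 \<Rightarrow> real^2"
  assumes w': "(w has_derivative L) (at x)" and w_lt: "\<forall>y. norm (w y) < vbar"
    and "0 < u" and "2 * norm (w x) \<le> u" and "u^2 \<le> vbar^2 - (norm (w x))^2"
    and D: "((\<lambda>t. fcost vbar w (x + t *\<^sub>R h) (p + t *\<^sub>R q)) has_real_derivative D) (at 0)"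
  shows "\<bar>D\<bar> \<le> 9 / (2 * u^2) * norm p * norm (L h) + 2 / u * norm q"
proof (cases "p = 0")
  case True
  have "D = 0"
  proof (rule DERIV_local_min[OF D, of 1])
    show "\<forall>t. \<bar>0 - t\<bar> < 1 \<longrightarrow> fcost vbar w (x + 0 *\<^sub>R h) (p + 0 *\<^sub>R q)
        \<le> fcost vbar w (x + t *\<^sub>R h) (p + t *\<^sub>R q)"
      using True w_lt by (simp add: fcost_nonneg)
  qed simp
  then show ?thesis using \<open>0 < u\<close> by simp
next
  case False
  have "D = fcost_p_deriv vbar (w x) p q + fcost_x_deriv vbar (w x) p (L h)"
    using DERIV_unique[OF D has_real_derivative_fcost_line[OF w' _ False]] w_lt by blast
  then show ?thesis
    using abs_fcost_p_deriv_le[OF False assms(3-5), of q]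
      abs_fcost_x_deriv_le[OF False assms(3-5), of "L h"]
    by linarith
qed

lemma norm_derivative_le:
  assumes "(f has_derivative L) (at x)" and "onorm (frechet_derivative f (at x)) \<le> c"
  shows "norm (L h) \<le> c * norm h"
proof -
  have "bounded_linear L" and "onorm L \<le> c"
    using assms frechet_derivative_at[OF assms(1)] by (auto dest: has_derivative_bounded_linear)
  show ?thesis
    using onorm[OF \<open>bounded_linear L\<close>] mult_right_mono[OF \<open>onorm L \<le> c\<close> norm_ge_zero]
    by (rule order_trans)
qed

lemma wind_speed_margin:
  fixes W c0 v :: real
  assumes "0 < v" and "0 \<le> W" and "W \<le> c0" and "c0 \<le> v / sqrt 5"
  shows "0 < sqrt (v^2 - c0^2)" and "2 * W \<le> sqrt (v^2 - c0^2)"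
    and "(sqrt (v^2 - c0^2))^2 \<le> v^2 - W^2"
proof -
  have "c0 * sqrt 5 \<le> v" using assms(4) by (simp add: field_simps)
  then have "(c0 * sqrt 5)^2 \<le> v^2" using assms(2,3) by (intro power_mono) auto
  then have "5 * c0^2 \<le> v^2" by (simp add: power_mult_distrib)
  moreover have "W^2 \<le> c0^2" using assms(2,3) by (intro power_mono)
  ultimately have "(2 * W)^2 \<le> v^2 - c0^2" and "c0^2 < v^2"
    using \<open>0 < v\<close> by (simp_all add: power_mult_distrib) (smt (verit) zero_less_power)+
  then show "0 < sqrt (v^2 - c0^2)" and "2 * W \<le> sqrt (v^2 - c0^2)"
    and "(sqrt (v^2 - c0^2))^2 \<le> v^2 - W^2"
    using \<open>W^2 \<le> c0^2\<close> by (simp_all add: real_le_rsqrt)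
qed

theorem lemma18:
  fixes vbar c0 c1 a :: real and xO xD :: "real^2" and w :: "real^2 \<Rightarrow> real^2"
    and \<xi> \<delta>\<xi> :: "real \<Rightarrow> real^2"
  assumes vbar_pos: "vbar > 0"
    and foci: "xO \<noteq> xD"
    and wC3: "C3 w"
    and w_lt: "\<forall>x. norm (w x) < vbar"
    and ell: "a > dist xO xD"
    and w_bd: "\<forall>x\<in>ellipse xO xD a. norm (w x) \<le> c0"
    and c0_bd: "c0 \<le> vbar / sqrt 5"
    and wx_bd: "\<forall>x\<in>ellipse xO xD a. onorm (frechet_derivative w (at x)) \<le> c1"
    and xi: "\<xi> \<in> trajX xO xD"
    and dxi: "\<delta>\<xi> \<in> deltaX"
  shows "\<forall>\<tau>\<in>{0<..<1}. \<forall>\<xi>t \<delta>\<xi>t D.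
           (\<xi> has_vector_derivative \<xi>t) (at \<tau>) \<and>
           (\<delta>\<xi> has_vector_derivative \<delta>\<xi>t) (at \<tau>) \<and>
           \<xi> \<tau> \<in> ellipse xO xD a \<and>
           ((\<lambda>t. fcost vbar w (\<xi> \<tau> + t *\<^sub>R \<delta>\<xi> \<tau>) (\<xi>t + t *\<^sub>R \<delta>\<xi>t))
              has_real_derivative D) (at 0)
         \<longrightarrow> \<bar>D\<bar> \<le> (21 * c1 / (4 * (vbar^2 - c0^2))) * norm \<xi>t * norm (\<delta>\<xi> \<tau>)
                    + (7 / (2 * sqrt (vbar^2 - c0^2))) * norm \<delta>\<xi>t"
proof (intro ballI allI impI, elim conjE)
  fix \<tau> p q D
  assume "(\<xi> has_vector_derivative p) (at \<tau>)" and "(\<delta>\<xi> has_vector_derivative q) (at \<tau>)"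
    and x_in: "\<xi> \<tau> \<in> ellipse xO xD a"
    and D: "((\<lambda>t. fcost vbar w (\<xi> \<tau> + t *\<^sub>R \<delta>\<xi> \<tau>) (p + t *\<^sub>R q)) has_real_derivative D) (at 0)"
  obtain L where w': "(w has_derivative L) (at (\<xi> \<tau>))"
    using wC3 unfolding C3_def by blast
  have L_le: "norm (L (\<delta>\<xi> \<tau>)) \<le> c1 * norm (\<delta>\<xi> \<tau>)"
    using norm_derivative_le[OF w'] wx_bd x_in by blast
  define u where "u = sqrt (vbar^2 - c0^2)"
  note margin = wind_speed_margin[OF vbar_pos norm_ge_zero w_bd[rule_format, OF x_in] c0_bd, folded u_def]
  have "\<bar>D\<bar> \<le> 9 / (2 * u^2) * norm p * norm (L (\<delta>\<xi> \<tau>)) + 2 / u * norm q"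
    using abs_fcost_line_deriv_le[OF w' w_lt margin D] .
  also have "\<dots> \<le> 21 * c1 / (4 * u^2) * norm p * norm (\<delta>\<xi> \<tau>) + 7 / (2 * u) * norm q"
  proof (intro add_mono)
    have "norm p * norm (L (\<delta>\<xi> \<tau>)) \<le> c1 * (norm p * norm (\<delta>\<xi> \<tau>))"
      using mult_left_mono[OF L_le norm_ge_zero[of p]] by (simp add: ac_simps)
    moreover have "0 \<le> norm p * norm (L (\<delta>\<xi> \<tau>))" by simp
    ultimately have "9 / 2 * (norm p * norm (L (\<delta>\<xi> \<tau>))) \<le> 21 / 4 * (c1 * (norm p * norm (\<delta>\<xi> \<tau>)))"
      by linarith
    then show "9 / (2 * u^2) * norm p * norm (L (\<delta>\<xi> \<tau>)) \<le> 21 * c1 / (4 * u^2) * norm p * norm (\<delta>\<xi> \<tau>)"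
      using margin(1) by (simp add: field_simps)
    show "2 / u * norm q \<le> 7 / (2 * u) * norm q"
      using margin(1) by (simp add: field_simps)
  qed
  finally show "\<bar>D\<bar> \<le> 21 * c1 / (4 * (vbar^2 - c0^2)) * norm p * norm (\<delta>\<xi> \<tau>)
      + 7 / (2 * sqrt (vbar^2 - c0^2)) * norm q"
    using margin(1) by (simp add: u_def)
qed

end
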